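(* Let $\Sigma$ be a structurally well-posed $n\times n$ signature matrix with essential sparsity pattern $S_{\mathrm{ess}}$. (i) Any irreducible block-triangular form of $S_{\mathrm{ess}}$ is block-diagonal, not merely block-triangular. (ii) All Jacobian sparsity patterns $S_0(c,d)$ of $\Sigma$, where $(c,d)$ ranges over the valid offset vectors of $\Sigma$, have the same irreducible emblem, which equals that of $S_{\mathrm{ess}}$.
   Context: A signature matrix is an $n\times n$ matrix $\Sigma=(\sigma_{ij})$ with entries in $\mathbb{Z}_{\ge0}\cup\{-\infty\}$. A transversal is a set $T$ of $n$ positions $(i,j)$ with exactly one in each row and each column; its value is $\sum_{(i,j)\in T}\sigma_{ij}$. $\Sigma$ is structurally well-posed if it has a transversal on which all $\sigma_{ij}$ are finite. A highest-value transversal (HVT) is a transversal of maximal value. The essential sparsity pattern $S_{\mathrm{ess}}$ is the union of all HVTs of $\Sigma$. A valid offset vector of $\Sigma$ is a pair $(c,d)$ of integer $n$-vectors with $c_i\ge0$ for all $i$, $d_j-c_i\ge\sigma_{ij}$ for all $i,j$, and $d_j-c_i=\sigma_{ij}$ for all $(i,j)$ on some HVT (equivalently, on every HVT). Its Jacobian sparsity pattern is $S_0(c,d)=\{(i,j): d_j-c_i=\sigma_{ij}\}$. A sparsity pattern is a subset $A$ of $\{1,\ldots,n\}^2$. A permuted square-block form consists of permutations $\rho$ (of rows) and $\kappa$ (of columns) of $\{1,\ldots,n\}$ together with positive integers $N_1,\ldots,N_p$ summing to $n$. Put $B_l=\{i : \sum_{r<l}N_r < i\le \sum_{r\le l}N_r\}$.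 The permuted pattern is $\widetilde A=\{(i,j):(\rho(i),\kappa(j))\in A\}$. The form puts $A$ into (upper) block-triangular form (BTF) if $\widetilde A\cap(B_k\times B_l)=\emptyset$ whenever $k>l$; it is block-diagonal if $\widetilde A\cap(B_k\times B_l)=\emptyset$ whenever $k\ne l$. A pattern is structurally nonsingular if it contains a transversal; a structurally nonsingular pattern is irreducible if no permuted square-block form with $p>1$ blocks puts it into BTF. A BTF of $A$ is irreducible if each diagonal sub-pattern $\widetilde A\cap(B_l\times B_l)$ is irreducible as an $N_l\times N_l$ pattern. The emblem of a permuted square-block form is the set of pairs $\{(R_1,C_1),\ldots,(R_p,C_p)\}$ where $R_l=\rho(B_l)$ and $C_l=\kappa(B_l)$ are the sets of original row and column labels in block $l$. Every structurally nonsingular pattern has an irreducible BTF, and all its irreducible BTFs have the same emblem, called its irreducible emblem. *)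

theory Defs
  imports "HOL-Library.Extended_Real" "HOL-Combinatorics.Permutations"
begin

section \<open>Signature matrices and transversals\<close>

text \<open>Rows and columns of an n-by-n matrix are labelled by the natural numbers 1, ..., n; values of
  functions outside this range are irrelevant. The entry set (nonnegative integers together with
  minus infinity) is embedded in \<^typ>\<open>ereal\<close>, whose addition and order give a transversal the value
  minus infinity as soon as one of its entries is minus infinity.\<close>

definition signature_matrix :: "nat \<Rightarrow> (nat \<Rightarrow> nat \<Rightarrow> ereal) \<Rightarrow> bool" where
  "signature_matrix n \<Sigma> \<longleftrightarrow>
     (\<forall>i\<in>{1..n}. \<forall>j\<in>{1..n}. \<Sigma> i j = -\<infinity> \<or> (\<exists>k::nat. \<Sigma> i j = ereal (real k)))"

definition transversal :: "nat \<Rightarrow> (nat \<times> nat) set \<Rightarrow> bool" where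
  "transversal n T \<longleftrightarrow>
     T \<subseteq> {1..n} \<times> {1..n} \<and>
     (\<forall>i\<in>{1..n}. \<exists>!j. (i, j) \<in> T) \<and>
     (\<forall>j\<in>{1..n}. \<exists>!i. (i, j) \<in> T)"

definition transversal_value :: "(nat \<Rightarrow> nat \<Rightarrow> ereal) \<Rightarrow> (nat \<times> nat) set \<Rightarrow> ereal" where
  "transversal_value \<Sigma> T = (\<Sum>(i, j)\<in>T. \<Sigma> i j)"

definition structurally_well_posed :: "nat \<Rightarrow> (nat \<Rightarrow> nat \<Rightarrow> ereal) \<Rightarrow> bool" where
  "structurally_well_posed n \<Sigma> \<longleftrightarrow>
     (\<exists>T. transversal n T \<and> (\<forall>(i, j)\<in>T. \<bar>\<Sigma> i j\<bar> \<noteq> \<infinity>))"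

definition HVT :: "nat \<Rightarrow> (nat \<Rightarrow> nat \<Rightarrow> ereal) \<Rightarrow> (nat \<times> nat) set \<Rightarrow> bool" where
  "HVT n \<Sigma> T \<longleftrightarrow>
     transversal n T \<and>
     (\<forall>T'. transversal n T' \<longrightarrow> transversal_value \<Sigma> T' \<le> transversal_value \<Sigma> T)"

definition S_ess :: "nat \<Rightarrow> (nat \<Rightarrow> nat \<Rightarrow> ereal) \<Rightarrow> (nat \<times> nat) set" where
  "S_ess n \<Sigma> = \<Union> {T. HVT n \<Sigma> T}"

definition valid_offset ::
  "nat \<Rightarrow> (nat \<Rightarrow> nat \<Rightarrow> ereal) \<Rightarrow> (nat \<Rightarrow> int) \<Rightarrow> (nat \<Rightarrow> int) \<Rightarrow> bool" where
  "valid_offset n \<Sigma> c d \<longleftrightarrow>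
     (\<forall>i\<in>{1..n}. c i \<ge> 0) \<and>
     (\<forall>i\<in>{1..n}. \<forall>j\<in>{1..n}. ereal (real_of_int (d j - c i)) \<ge> \<Sigma> i j) \<and>
     (\<exists>T. HVT n \<Sigma> T \<and> (\<forall>(i, j)\<in>T. ereal (real_of_int (d j - c i)) = \<Sigma> i j))"

definition S_0 ::
  "nat \<Rightarrow> (nat \<Rightarrow> nat \<Rightarrow> ereal) \<Rightarrow> (nat \<Rightarrow> int) \<Rightarrow> (nat \<Rightarrow> int) \<Rightarrow> (nat \<times> nat) set" where
  "S_0 n \<Sigma> c d = {(i, j) \<in> {1..n} \<times> {1..n}. ereal (real_of_int (d j - c i)) = \<Sigma> i j}"

section \<open>Permuted square-block forms\<close>

text \<open>The block sizes are a list \<open>N\<close>, indexed from 0, so \<open>block N l\<close> with \<open>l < length N\<close> is the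
  block usually numbered \<open>l + 1\<close>.\<close>

definition square_block_form :: "nat \<Rightarrow> (nat \<Rightarrow> nat) \<Rightarrow> (nat \<Rightarrow> nat) \<Rightarrow> nat list \<Rightarrow> bool" where
  "square_block_form n \<rho> \<kappa> N \<longleftrightarrow>
     \<rho> permutes {1..n} \<and> \<kappa> permutes {1..n} \<and> (\<forall>m\<in>set N. m > 0) \<and> sum_list N = n"

definition block :: "nat list \<Rightarrow> nat \<Rightarrow> nat set" where
  "block N l = {i. sum_list (take l N) < i \<and> i \<le> sum_list (take (Suc l) N)}"

definition permuted_pattern ::
  "nat \<Rightarrow> (nat \<Rightarrow> nat) \<Rightarrow> (nat \<Rightarrow> nat) \<Rightarrow> (nat \<times> nat) set \<Rightarrow> (nat \<times> nat) set" where
  "permuted_pattern n \<rho> \<kappa> A = {(i, j) \<in> {1..n} \<times> {1..n}. (\<rho> i, \<kappa> j) \<in> A}"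

definition block_triangular_form ::
  "nat \<Rightarrow> (nat \<times> nat) set \<Rightarrow> (nat \<Rightarrow> nat) \<Rightarrow> (nat \<Rightarrow> nat) \<Rightarrow> nat list \<Rightarrow> bool" where
  "block_triangular_form n A \<rho> \<kappa> N \<longleftrightarrow>
     square_block_form n \<rho> \<kappa> N \<and>
     (\<forall>k<length N. \<forall>l<length N. k > l \<longrightarrow>
        permuted_pattern n \<rho> \<kappa> A \<inter> (block N k \<times> block N l) = {})"

definition block_diagonal_form ::
  "nat \<Rightarrow> (nat \<times> nat) set \<Rightarrow> (nat \<Rightarrow> nat) \<Rightarrow> (nat \<Rightarrow> nat) \<Rightarrow> nat list \<Rightarrow> bool" where
  "block_diagonal_form n A \<rho> \<kappa> N \<longleftrightarrow>
     square_block_form n \<rho> \<kappa> N \<and>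
     (\<forall>k<length N. \<forall>l<length N. k \<noteq> l \<longrightarrow>
        permuted_pattern n \<rho> \<kappa> A \<inter> (block N k \<times> block N l) = {})"

section \<open>Irreducibility and emblems\<close>

definition structurally_nonsingular :: "nat \<Rightarrow> (nat \<times> nat) set \<Rightarrow> bool" where
  "structurally_nonsingular n A \<longleftrightarrow> (\<exists>T. transversal n T \<and> T \<subseteq> A)"

definition irreducible_pattern :: "nat \<Rightarrow> (nat \<times> nat) set \<Rightarrow> bool" where
  "irreducible_pattern n A \<longleftrightarrow>
     structurally_nonsingular n A \<and>
     \<not> (\<exists>\<rho> \<kappa> N. length N > 1 \<and> block_triangular_form n A \<rho> \<kappa> N)"

text \<open>The diagonal sub-pattern in block \<open>l\<close>, shifted so that its labels are 1, ..., \<open>N ! l\<close>.\<close>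

definition diagonal_subpattern ::
  "nat \<Rightarrow> (nat \<times> nat) set \<Rightarrow> (nat \<Rightarrow> nat) \<Rightarrow> (nat \<Rightarrow> nat) \<Rightarrow> nat list \<Rightarrow> nat \<Rightarrow> (nat \<times> nat) set" where
  "diagonal_subpattern n A \<rho> \<kappa> N l =
     {(i, j). (sum_list (take l N) + i, sum_list (take l N) + j)
                \<in> permuted_pattern n \<rho> \<kappa> A \<inter> (block N l \<times> block N l)}"

definition irreducible_BTF ::
  "nat \<Rightarrow> (nat \<times> nat) set \<Rightarrow> (nat \<Rightarrow> nat) \<Rightarrow> (nat \<Rightarrow> nat) \<Rightarrow> nat list \<Rightarrow> bool" where
  "irreducible_BTF n A \<rho> \<kappa> N \<longleftrightarrow>
     block_triangular_form n A \<rho> \<kappa> N \<and>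
     (\<forall>l<length N. irreducible_pattern (N ! l) (diagonal_subpattern n A \<rho> \<kappa> N l))"

definition emblem :: "(nat \<Rightarrow> nat) \<Rightarrow> (nat \<Rightarrow> nat) \<Rightarrow> nat list \<Rightarrow> (nat set \<times> nat set) set" where
  "emblem \<rho> \<kappa> N = {(\<rho> ` block N l, \<kappa> ` block N l) | l. l < length N}"

text \<open>\<open>E\<close> is the irreducible emblem of \<open>A\<close>: irreducible block-triangular forms of \<open>A\<close> exist and all of
  them have emblem \<open>E\<close>. As a relation this determines \<open>E\<close> uniquely, without presupposing (as a
  definite description would) that such an \<open>E\<close> exists.\<close>

definition is_irreducible_emblem ::
  "nat \<Rightarrow> (nat \<times> nat) set \<Rightarrow> (nat set \<times> nat set) set \<Rightarrow> bool" where
  "is_irreducible_emblem n A E \<longleftrightarrow>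
     (\<exists>\<rho> \<kappa> N. irreducible_BTF n A \<rho> \<kappa> N) \<and>
     (\<forall>\<rho> \<kappa> N. irreducible_BTF n A \<rho> \<kappa> N \<longrightarrow> emblem \<rho> \<kappa> N = E)"

end

theory Submission
  imports Defs "HOL-Library.Transitive_Closure_Table" "HOL-Library.Disjoint_Sets"
    "HOL-Combinatorics.Cycles"
begin

text \<open>Fix a highest-value transversal and use it to identify columns with rows; every pattern containing
  it becomes a digraph on the rows, and its irreducible emblem consists of the strong components of
  that digraph. The value of a transversal is at most \<open>\<Sum>d - \<Sum>c\<close>, with equality exactly when it lies in
  \<open>S_0 c d\<close>, so the transversals inside \<open>S_0 c d\<close> are the highest-value ones. An edge of \<open>S_0 c d\<close>
  inside a strong component lies on a simple cycle, hence on a transversal inside \<open>S_0 c d\<close>, hence in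
  \<open>S_ess\<close>; so both patterns have the same strong components. An edge of \<open>S_ess\<close> lies on a
  highest-value transversal, which differs from the fixed one by a permutation, so the edge lies on a
  cycle and never joins two components.\<close>

section \<open>Intervals of indices cut out by the block sizes\<close>

section \<open>Blocks\<close>

lemma sum_list_take_mono:
  fixes N :: "nat list"
  assumes "k \<le> l"
  shows "sum_list (take k N) \<le> sum_list (take l N)"
proof -
  have "take l N = take k N @ take (l - k) (drop k N)"
    using assms by (metis add_diff_inverse_nat not_le take_add)
  then show ?thesis by simp
qed

lemma block_Suc:
  assumes "l < length N"
  shows "block N l = {sum_list (take l N)<..sum_list (take l N) + N ! l}"
  using assms by (auto simp: block_def take_Suc_conv_app_nth)

lemma card_block: "l < length N \<Longrightarrow> card (block N l) = N ! l"
  by (simp add: block_Suc)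

lemma finite_block: "finite (block N l)"
  unfolding block_def by (rule finite_subset[of _ "{..sum_list (take (Suc l) N)}"]) auto

lemma block_less:
  assumes "k < l" "i \<in> block N k" "j \<in> block N l"
  shows "i < j"
  using assms sum_list_take_mono[of "Suc k" l N] by (auto simp: block_def)

lemma block_disjoint: "k \<noteq> l \<Longrightarrow> block N k \<inter> block N l = {}"
proof (rule equals0I)
  fix i assume "k \<noteq> l" "i \<in> block N k \<inter> block N l"
  then show False using block_less[of k l i N i] block_less[of l k i N i] by (auto simp: neq_iff)
qed

lemma block_index:
  assumes "i \<in> {1..sum_list N}"
  obtains l where "l < length N" "i \<in> block N l"
proof -
  \<comment> \<open>The least \<open>l\<close> whose partial sum reaches \<open>i\<close>;
    minimality supplies the strict lower bound in \<open>block\<close>.\<close>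
  define l where "l = (LEAST l. i \<le> sum_list (take (Suc l) N))"
  have ne: "N \<noteq> []" using assms by auto
  have "i \<le> sum_list (take (Suc (length N - 1)) N)" using assms by auto
  then have le: "i \<le> sum_list (take (Suc l) N)" and "l \<le> length N - 1"
    unfolding l_def by (rule LeastI, rule Least_le)
  have "sum_list (take l N) < i"
  proof (cases l)
    case 0
    then show ?thesis using assms by auto
  next
    case (Suc m)
    then have "m < l" by simp
    then show ?thesis using not_less_Least[of m "\<lambda>l. i \<le> sum_list (take (Suc l) N)"] Suc
      unfolding l_def[symmetric] by auto
  qed
  moreover have "l < length N"
    using ne \<open>l \<le> length N - 1\<close> by (cases N) auto
  ultimately show ?thesis
    using le by (intro that[of l]) (auto simp: block_def)
qed

lemma block_subset: "block N l \<subseteq> {1..sum_list N}"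
  \<comment> \<open>The maximum covers \<open>l\<close> beyond the end of the list as well, where
    the block is empty.\<close>
  using sum_list_take_mono[of "Suc l" "max (Suc l) (length N)" N] by (auto simp: block_def)

lemma UN_block: "(\<Union>l<length N. block N l) = {1..sum_list N}"
proof (intro equalityI subsetI)
  fix i assume "i \<in> {1..sum_list N}"
  then obtain l where "l < length N" "i \<in> block N l" by (rule block_index)
  then show "i \<in> (\<Union>l<length N. block N l)" by blast
qed (use block_subset in blast)

text \<open>Turns an ordered partition into the data of a square-block form: block \<open>l\<close>
  and part \<open>l\<close> have equal size, so bijections between them exist and glue to one
  permutation. Positivity of the sizes is left to each use.\<close>

lemma permutation_of_partition:
  assumes disj: "disjoint_family_on ((!) Cs) {..<length Cs}"
    and un: "\<Union> (set Cs) = {1..n::nat}"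
  obtains \<rho> where "\<rho> permutes {1..n}" "sum_list (map card Cs) = n"
    "\<And>l. l < length Cs \<Longrightarrow> \<rho> ` block (map card Cs) l = Cs ! l"
proof -
  define N where "N = map card Cs"
  have len: "length N = length Cs" by (simp add: N_def)
  have un': "(\<Union>l<length Cs. Cs ! l) = {1..n}"
    using un nth_image[of "length Cs" Cs] by (simp add: lessThan_atLeast0)
  have fin: "finite (Cs ! l)" if "l < length Cs" for l
    by (rule finite_subset[of _ "{1..n}"]) (use that un' in auto)
  have "card (\<Union>l<length Cs. Cs ! l) = (\<Sum>l<length Cs. card (Cs ! l))"
    using disj fin by (intro card_UN_disjoint) (auto simp: disjoint_family_on_def)
  then have n: "sum_list N = n"
    unfolding un' by (simp add: N_def sum_list_sum_nth lessThan_atLeast0)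
  have "\<exists>g. bij_betw g (block N l) (Cs ! l)" if "l < length Cs" for l
    using that fin card_block[of l N]
    by (intro finite_same_card_bij) (auto simp: finite_block len N_def)
  then obtain g where g: "\<And>l. l < length Cs \<Longrightarrow> bij_betw (g l) (block N l) (Cs ! l)"
    by metis
  define \<rho> where "\<rho> i = (if i \<in> {1..n} then g (THE l. i \<in> block N l) i else i)" for i
  have \<rho>: "bij_betw \<rho> (block N l) (Cs ! l)" if "l < length Cs" for l
  proof -
    have "\<rho> i = g l i" if "i \<in> block N l" for i
    proof -
      have "(THE l. i \<in> block N l) = l"
        using that block_disjoint[of _ l N] by (intro the_equality) auto
      then show ?thesis using that block_subset[of N l] n by (auto simp: \<rho>_def)
    qed
    then show ?thesis using g[OF that] by (simp cong: bij_betw_cong)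
  qed
  have "bij_betw \<rho> (\<Union>l<length Cs. block N l) (\<Union>l<length Cs. Cs ! l)"
    using disj \<rho> by (intro bij_betw_UNION_disjoint) auto
  then have "bij_betw \<rho> {1..n} {1..n}"
    using UN_block[of N] by (simp add: un' len n)
  then have "\<rho> permutes {1..n}"
    by (rule bij_imp_permutes) (auto simp: \<rho>_def)
  with \<rho> n show ?thesis
    by (intro that[of \<rho>]) (auto simp: N_def bij_betw_imp_surj_on)
qed

section \<open>Irreducibility as the absence of a two-block splitting\<close>

section \<open>Irreducibility\<close>

text \<open>Two blocks suffice to detect reducibility. The rows \<open>X\<close> of the last block
  of a triangular form have entries only in the equally many columns \<open>Y\<close> of that block;
  conversely, such \<open>X\<close> and \<open>Y\<close> form the last of two blocks. Permutations
  and block lists thereby leave the notion of irreducibility.\<close>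

lemma irreducible_pattern_iff:
  "irreducible_pattern m B \<longleftrightarrow> structurally_nonsingular m B \<and>
    \<not> (\<exists>X Y. X \<subset> {1..m} \<and> X \<noteq> {} \<and> Y \<subseteq> {1..m} \<and> card X = card Y \<and> B \<inter> X \<times> ({1..m} - Y) = {})"
proof -
  have "(\<exists>\<rho> \<kappa> N. length N > 1 \<and> block_triangular_form m B \<rho> \<kappa> N) \<longleftrightarrow>
    (\<exists>X Y. X \<subset> {1..m} \<and> X \<noteq> {} \<and> Y \<subseteq> {1..m} \<and> card X = card Y \<and> B \<inter> X \<times> ({1..m} - Y) = {})"
    (is "?L = ?R")
  proof
    assume ?L
    then obtain \<rho> \<kappa> N where len: "length N > 1" and btf: "block_triangular_form m B \<rho> \<kappa> N" by blast
    then have sq: "\<rho> permutes {1..m}" "\<kappa> permutes {1..m}" "\<forall>m\<in>set N. m > 0" "sum_list N = m"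
      by (auto simp: block_triangular_form_def square_block_form_def)
    define k where "k = length N - 1"
    have k: "k < length N" "0 < k" using len by (auto simp: k_def)
    have pos: "block N l \<noteq> {}" if "l < length N" for l
      using that sq(3) by (simp add: block_Suc)
    define X where "X = \<rho> ` block N k"
    define Y where "Y = \<kappa> ` block N k"
    have sub: "block N k \<subset> {1..m}"
    proof
      show "block N k \<subseteq> {1..m}" using block_subset[of N k] sq(4) by simp
      have "block N 0 \<noteq> {}" using pos[of 0] k by linarith
      moreover have "block N 0 \<subseteq> {1..m}" using block_subset[of N 0] sq(4) by simp
      ultimately show "block N k \<noteq> {1..m}" using block_disjoint[of 0 k N] k by blast
    qed
    have "X \<subset> {1..m}"
      using image_strict_mono[OF permutes_inj_on[OF sq(1)] sub] permutes_image[OF sq(1)]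
      by (simp add: X_def)
    moreover have "X \<noteq> {}" using pos k by (simp add: X_def)
    moreover have "Y \<subseteq> {1..m}"
      using image_mono[of _ "{1..m}" \<kappa>] sub permutes_image[OF sq(2)] by (simp add: Y_def)
    moreover have "card X = card Y"
      by (simp add: X_def Y_def card_image permutes_inj_on[OF sq(1)] permutes_inj_on[OF sq(2)])
    moreover have "(x, y) \<notin> B" if xy: "x \<in> X" "y \<in> {1..m} - Y" for x y
    proof
      assume B: "(x, y) \<in> B"
      obtain i where i: "i \<in> block N k" "x = \<rho> i" using xy by (auto simp: X_def)
      obtain j where j: "j \<in> {1..m}" "y = \<kappa> j"
        using xy permutes_image[OF sq(2)] by blast
      obtain l where l: "l < length N" "j \<in> block N l" using j sq(4) block_index by blast
      have "l \<noteq> k" using l j xy by (auto simp: Y_def)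
      then have "l < k" using l by (simp add: k_def)
      then have "permuted_pattern m \<rho> \<kappa> B \<inter> (block N k \<times> block N l) = {}"
        using btf k l by (auto simp: block_triangular_form_def)
      moreover have "i \<in> {1..m}" using i sub by blast
      ultimately show False using B i j l by (auto simp: permuted_pattern_def)
    qed
    ultimately show ?R by blast
  next
    assume ?R
    then obtain X Y where X: "X \<subset> {1..m}" "X \<noteq> {}" and Y: "Y \<subseteq> {1..m}" and c: "card X = card Y"
      and B: "B \<inter> X \<times> ({1..m} - Y) = {}" by blast
    have finX: "finite X" and finY: "finite Y" using X Y finite_subset[of _ "{1..m}"] by blast+
    \<comment> \<open>Equal size lists allow the row and column permutations to share the same
      \<open>N\<close>.\<close>
    have cc: "map card [{1..m} - X, X] = map card [{1..m} - Y, Y]"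
      using c X Y finX finY by (simp add: card_Diff_subset)
    define N where "N = map card [{1..m} - X, X]"
    have NY: "map card [{1..m} - Y, Y] = N" unfolding N_def cc ..
    have dj: "disjoint_family_on ((!) [{1..m} - Z, Z]) {..<length [{1..m} - Z, Z]}" for Z
      by (auto simp: disjoint_family_on_def less_Suc_eq nth_Cons')
    obtain \<rho> where \<rho>: "\<rho> permutes {1..m}" "sum_list N = m"
      "\<And>l. l < 2 \<Longrightarrow> \<rho> ` block N l = [{1..m} - X, X] ! l"
      by (rule permutation_of_partition[OF dj[of X], of m]) (use X in \<open>auto simp: N_def\<close>)
    obtain \<kappa> where \<kappa>: "\<kappa> permutes {1..m}"
      "\<And>l. l < 2 \<Longrightarrow> \<kappa> ` block N l = [{1..m} - Y, Y] ! l"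
      by (rule permutation_of_partition[OF dj[of Y], of m, unfolded NY]) (use Y in auto)
    have "\<forall>m\<in>set N. m > 0" using X finX by (auto simp: N_def card_gt_0_iff)
    moreover have "permuted_pattern m \<rho> \<kappa> B \<inter> (block N k \<times> block N l) = {}"
      if "k < length N" "l < length N" "l < k" for k l
    proof -
      have "k = 1" "l = 0" using that by (auto simp: N_def)
      then have im: "\<rho> ` block N k = X" "\<kappa> ` block N l = {1..m} - Y"
        using \<rho>(3)[of 1] \<kappa>(2)[of 0] by auto
      have "(\<rho> i, \<kappa> j) \<notin> B" if "i \<in> block N k" "j \<in> block N l" for i j
        using B imageI[OF that(1), of \<rho>] imageI[OF that(2), of \<kappa>] unfolding im by blast
      then show ?thesis by (auto simp: permuted_pattern_def)
    qed
    ultimately have "block_triangular_form m B \<rho> \<kappa> N"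
      using \<rho> \<kappa> by (auto simp: block_triangular_form_def square_block_form_def)
    then show ?L by (intro exI[of _ \<rho>] exI[of _ \<kappa>] exI[of _ N]) (simp add: N_def)
  qed
  then show ?thesis unfolding irreducible_pattern_def by blast
qed

section \<open>Strong components\<close>

text \<open>A transversal contained in a pattern, viewed as a permutation \<open>\<tau>\<close> matching rows with columns,
  identifies each column with a row and thereby turns the pattern into a digraph on the rows.\<close>

definition row_digraph :: "nat \<Rightarrow> (nat \<Rightarrow> nat) \<Rightarrow> (nat \<times> nat) set \<Rightarrow> (nat \<times> nat) set" where
  "row_digraph n \<tau> A = {(x, y) \<in> {1..n} \<times> {1..n}. (x, \<tau> y) \<in> A}"

definition strong_component :: "nat \<Rightarrow> (nat \<times> nat) set \<Rightarrow> nat \<Rightarrow> nat set" where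
  "strong_component n R x = {y \<in> {1..n}. (x, y) \<in> R\<^sup>* \<and> (y, x) \<in> R\<^sup>*}"

text \<open>The candidate for the irreducible emblem, obtained from the digraph alone and without
  choosing a block form.\<close>

definition matching_emblem ::
  "nat \<Rightarrow> (nat \<Rightarrow> nat) \<Rightarrow> (nat \<times> nat) set \<Rightarrow> (nat set \<times> nat set) set" where
  "matching_emblem n \<tau> A =
     (\<lambda>x. (strong_component n (row_digraph n \<tau> A) x, \<tau> ` strong_component n (row_digraph n \<tau> A) x)) ` {1..n}"

lemma row_digraph_rtrancl_range:
  "(x, y) \<in> (row_digraph n \<tau> A)\<^sup>* \<Longrightarrow> x \<in> {1..n} \<Longrightarrow> y \<in> {1..n}"
  by (induction rule: rtrancl_induct) (auto simp: row_digraph_def)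

section \<open>Block-triangular forms of a pattern that contains a fixed matching\<close>

locale matched_pattern =
  fixes n :: nat and \<tau> :: "nat \<Rightarrow> nat" and A :: "(nat \<times> nat) set"
  assumes perm: "\<tau> permutes {1..n}"
    and matched: "x \<in> {1..n} \<Longrightarrow> (x, \<tau> x) \<in> A"
begin

abbreviation "R \<equiv> row_digraph n \<tau> A"

text \<open>Let \<open>\<pi>\<close> send the position of a row to the position of its matched
  column. Matched entries avoid the region below the diagonal blocks, so \<open>\<pi>\<close> never
  lowers the block index and maps every tail of positions into itself. Being injective on a finite
  set, it maps each tail onto itself, and a block is a difference of two tails.\<close>

lemma btf_columns:
  assumes btf: "block_triangular_form n A \<rho> \<kappa> N" and l: "l < length N"
  shows "\<kappa> ` block N l = \<tau> ` \<rho> ` block N l"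
proof -
  have sq: "\<rho> permutes {1..n}" "\<kappa> permutes {1..n}" "sum_list N = n"
    using btf by (auto simp: block_triangular_form_def square_block_form_def)
  define \<pi> where "\<pi> = inv \<kappa> \<circ> (\<tau> \<circ> \<rho>)"
  have \<pi>: "\<pi> permutes {1..n}"
    unfolding \<pi>_def by (intro permutes_compose sq perm permutes_inv)
  have \<kappa>\<pi>: "\<kappa> (\<pi> i) = \<tau> (\<rho> i)" for i
    using permutes_inverses(1)[OF sq(2)] by (simp add: \<pi>_def)
  define s where "s k = sum_list (take k N)" for k
  have tail: "\<pi> ` {s k<..n} = {s k<..n}" for k
  proof (rule endo_inj_surj)
    show "\<pi> ` {s k<..n} \<subseteq> {s k<..n}"
    proof (rule image_subsetI)
      fix i assume i: "i \<in> {s k<..n}"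
      have i1: "i \<in> {1..n}" using i by auto
      then obtain m where m: "m < length N" "i \<in> block N m" using block_index sq(3) by metis
      have \<pi>i: "\<pi> i \<in> {1..n}" using i1 permutes_in_image[OF \<pi>] by blast
      then obtain q where q: "q < length N" "\<pi> i \<in> block N q" using block_index sq(3) by metis
      have "\<rho> i \<in> {1..n}" using i1 permutes_in_image[OF sq(1)] by blast
      then have "(i, \<pi> i) \<in> permuted_pattern n \<rho> \<kappa> A"
        using matched i1 \<pi>i by (auto simp: permuted_pattern_def \<kappa>\<pi>)
      then have "\<not> q < m"
        using btf m q by (auto simp: block_triangular_form_def)
      moreover have "\<not> m < k"
        using i m(2) sum_list_take_mono[of "Suc m" k N] by (auto simp: block_def s_def)
      ultimately have "k \<le> q" by simp
      then have "s k < \<pi> i"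
        using q(2) sum_list_take_mono[of k q N] by (auto simp: block_def s_def)
      then show "\<pi> i \<in> {s k<..n}" using \<pi>i by auto
    qed
  qed (use permutes_inj_on[OF \<pi>] in auto)
  have "s (Suc l) \<le> n"
    using sum_list_take_mono[of "Suc l" "length N" N] l sq(3) by (simp add: s_def)
  then have block: "block N l = {s l<..n} - {s (Suc l)<..n}"
    by (auto simp: block_def s_def)
  have "\<pi> ` block N l = block N l"
    unfolding block by (simp add: image_set_diff[OF permutes_inj[OF \<pi>]] tail)
  then have "\<kappa> ` block N l = (\<lambda>i. \<kappa> (\<pi> i)) ` block N l"
    by (metis image_image)
  then show ?thesis by (simp add: \<kappa>\<pi> image_image)
qed

text \<open>Expresses irreducibility of a diagonal block in the digraph: \<open>R\<close> leaves no
  nonempty proper subset of its rows closed within the block. Since the columns of the block are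
  those matched to its rows, the matching restricts to a transversal of the block, and only
  splittings remain to be compared with closed sets.\<close>

lemma diagonal_subpattern_irreducible_iff:
  assumes sq: "square_block_form n \<rho> \<kappa> N" and l: "l < length N"
    and cols: "\<kappa> ` block N l = \<tau> ` \<rho> ` block N l"
  shows "irreducible_pattern (N ! l) (diagonal_subpattern n A \<rho> \<kappa> N l) \<longleftrightarrow>
    (\<forall>X. X \<subseteq> \<rho> ` block N l \<and> X \<noteq> {} \<and> R `` X \<inter> \<rho> ` block N l \<subseteq> X \<longrightarrow> X = \<rho> ` block N l)"
proof -
  define s where "s = sum_list (take l N)"
  define m where "m = N ! l"
  \<comment> \<open>\<open>f\<close> and \<open>g\<close> lead from the local labels 1, ...,
    \<open>m\<close> of the block to the original row and column labels.\<close>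
  define f where "f i = \<rho> (s + i)" for i
  define g where "g j = \<kappa> (s + j)" for j
  define U where "U = \<rho> ` block N l"
  define D where "D = diagonal_subpattern n A \<rho> \<kappa> N l"
  have perms: "\<rho> permutes {1..n}" "\<kappa> permutes {1..n}" and n: "sum_list N = n"
    using sq by (auto simp: square_block_form_def)
  have block: "block N l = (+) s ` {1..m}"
    by (simp add: block_Suc[OF l] s_def m_def image_add_atLeastAtMost)
       (simp add: atLeastSucAtMost_greaterThanAtMost add.commute)
  have sub: "block N l \<subseteq> {1..n}" using block_subset n by blast
  have injf: "inj f"
    by (rule injI) (simp add: f_def inj_eq[OF permutes_inj[OF perms(1)]])
  have injg: "inj g"
    by (rule injI) (simp add: g_def inj_eq[OF permutes_inj[OF perms(2)]])
  have U: "U = f ` {1..m}"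
    unfolding U_def block image_image f_def ..
  have V: "\<tau> ` U = g ` {1..m}"
    unfolding U_def cols[symmetric] unfolding block image_image g_def ..
  have Un: "U \<subseteq> {1..n}"
    using sub permutes_image[OF perms(1)] unfolding U_def by blast
  have inj\<tau>: "inj \<tau>" using permutes_inj[OF perm] .
  have D: "(i, j) \<in> D \<longleftrightarrow> i \<in> {1..m} \<and> j \<in> {1..m} \<and> (f i, g j) \<in> A" for i j
  proof -
    have "s + i \<in> block N l \<longleftrightarrow> i \<in> {1..m}" for i
      by (auto simp: block_Suc[OF l] s_def m_def)
    then show ?thesis using sub
      unfolding D_def diagonal_subpattern_def permuted_pattern_def f_def g_def s_def[symmetric] by blast
  qed
  have edge: "(f i, y) \<in> R \<longleftrightarrow> (i, j) \<in> D"
    if "i \<in> {1..m}" "j \<in> {1..m}" "y \<in> U" "\<tau> y = g j" for i j y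
  proof -
    have "f i \<in> {1..n}" "y \<in> {1..n}" using that(1,3) Un U by blast+
    then show ?thesis using that by (simp add: row_digraph_def D)
  qed
  have col: "\<exists>j\<in>{1..m}. \<tau> y = g j" if "y \<in> U" for y using V that by blast
  have row: "\<exists>y\<in>U. \<tau> y = g j" if "j \<in> {1..m}" for j
  proof -
    have "g j \<in> \<tau> ` U" using V that by simp
    then show ?thesis by force
  qed
  have "transversal m {(i, j) \<in> {1..m} \<times> {1..m}. \<tau> (f i) = g j}"
    unfolding transversal_def
  proof (intro conjI ballI)
    fix i assume i: "i \<in> {1..m}"
    then obtain j where "j \<in> {1..m}" "\<tau> (f i) = g j"
      using col[of "f i"] U by blast
    then show "\<exists>!j. (i, j) \<in> {(i, j) \<in> {1..m} \<times> {1..m}. \<tau> (f i) = g j}"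
      using i by (intro ex1I[of _ j]) (auto simp: inj_eq[OF injg])
  next
    fix j assume j: "j \<in> {1..m}"
    then obtain i where "i \<in> {1..m}" "g j = \<tau> (f i)"
      using row[of j] U by (metis imageE)
    then show "\<exists>!i. (i, j) \<in> {(i, j) \<in> {1..m} \<times> {1..m}. \<tau> (f i) = g j}"
      using j by (intro ex1I[of _ i]) (auto simp: inj_eq[OF injf] inj_eq[OF inj\<tau>])
  qed auto
  moreover have "{(i, j) \<in> {1..m} \<times> {1..m}. \<tau> (f i) = g j} \<subseteq> D"
  proof (clarify)
    fix i j assume ij: "i \<in> {1..m}" "j \<in> {1..m}" "\<tau> (f i) = g j"
    then have "f i \<in> {1..n}" using U Un by blast
    then show "(i, j) \<in> D" using matched[of "f i"] ij by (simp add: D)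
  qed
  ultimately have nonsing: "structurally_nonsingular m D"
    unfolding structurally_nonsingular_def by blast
  have "(\<exists>X Y. X \<subset> {1..m} \<and> X \<noteq> {} \<and> Y \<subseteq> {1..m} \<and> card X = card Y \<and> D \<inter> X \<times> ({1..m} - Y) = {})
    \<longleftrightarrow> (\<exists>X. X \<subset> U \<and> X \<noteq> {} \<and> R `` X \<inter> U \<subseteq> X)" (is "?L \<longleftrightarrow> ?R")
  proof
    assume ?L
    then obtain X Y where X: "X \<subset> {1..m}" "X \<noteq> {}" and Y: "Y \<subseteq> {1..m}" "card X = card Y"
      and DXY: "D \<inter> X \<times> ({1..m} - Y) = {}" by blast
    have XU: "f ` X \<subset> U"
      unfolding U using image_strict_mono[OF inj_on_subset[OF injf subset_UNIV] X(1)] .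
    \<comment> \<open>The loops that the matching gives in \<open>R\<close> force the columns
      matched to \<open>X\<close> into \<open>Y\<close>. By cardinality they exhaust
      \<open>Y\<close>, so the row set alone determines the splitting.\<close>
    have "\<tau> ` f ` X \<subseteq> g ` Y"
    proof (clarify)
      fix i assume i: "i \<in> X"
      then have fi: "f i \<in> U" using XU by blast
      then obtain j where j: "j \<in> {1..m}" "\<tau> (f i) = g j" using col by blast
      have "(f i, f i) \<in> R" using fi Un matched by (auto simp: row_digraph_def)
      then have "(i, j) \<in> D" using edge[of i j "f i"] i j fi X by auto
      then have "j \<in> Y" using DXY i j by blast
      then show "\<tau> (f i) \<in> g ` Y" using j by blast
    qed
    moreover have "card (\<tau> ` f ` X) = card (g ` Y)"
      using Y(2) by (simp add: card_image inj_on_subset[OF injf subset_UNIV]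
          inj_on_subset[OF injg subset_UNIV] inj_on_subset[OF inj\<tau> subset_UNIV])
    moreover have "finite (g ` Y)" using Y finite_subset by blast
    ultimately have eq: "\<tau> ` f ` X = g ` Y" by (metis card_subset_eq)
    have "y \<in> f ` X" if "i \<in> X" "(f i, y) \<in> R" "y \<in> U" for i y
    proof -
      from col[OF \<open>y \<in> U\<close>] obtain j where j: "j \<in> {1..m}" "\<tau> y = g j" by blast
      then have "(i, j) \<in> D" using edge[of i j y] that X by auto
      then have "j \<in> Y" using DXY that j by blast
      then have "\<tau> y \<in> \<tau> ` f ` X" using j eq by auto
      then show ?thesis using inj_image_mem_iff[OF inj\<tau>] by blast
    qed
    then show ?R using XU X(2) by (intro exI[of _ "f ` X"]) auto
  next
    assume ?R
    then obtain X where X: "X \<subset> U" "X \<noteq> {}" "R `` X \<inter> U \<subseteq> X" by blast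
    define X' where "X' = {i \<in> {1..m}. f i \<in> X}"
    define Y' where "Y' = {j \<in> {1..m}. g j \<in> \<tau> ` X}"
    have fX: "f ` X' = X" using X U by (auto simp: X'_def)
    have "g ` {j \<in> S. g j \<in> Z} = Z" if "Z \<subseteq> g ` S" for S Z
      using that by auto
    moreover have "\<tau> ` X \<subseteq> g ` {1..m}" unfolding V[symmetric] using X by (intro image_mono) simp
    ultimately have gY: "g ` Y' = \<tau> ` X" unfolding Y'_def .
    have "card X' = card Y'"
    proof -
      have "card X' = card (\<tau> ` f ` X')" "card Y' = card (g ` Y')"
        by (simp_all add: card_image inj_on_subset[OF injf subset_UNIV]
            inj_on_subset[OF injg subset_UNIV] inj_on_subset[OF inj\<tau> subset_UNIV])
      then show ?thesis by (simp only: fX gY)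
    qed
    moreover have "X' \<subset> {1..m}" using fX X U by (auto simp: X'_def)
    moreover have "X' \<noteq> {}" using fX X by auto
    moreover have "Y' \<subseteq> {1..m}" by (auto simp: Y'_def)
    moreover have "(i, j) \<notin> D" if ij: "i \<in> X'" "j \<in> {1..m} - Y'" for i j
    proof
      assume "(i, j) \<in> D"
      obtain y where y: "y \<in> U" "\<tau> y = g j" using row ij by blast
      then have "(f i, y) \<in> R" using edge[of i j y] \<open>(i, j) \<in> D\<close> ij by (auto simp: X'_def)
      then have "y \<in> X" using X(3) y ij by (auto simp: X'_def)
      then have "g j \<in> \<tau> ` X" using y(2) by (metis imageI)
      then show False using ij(2) unfolding Y'_def by blast
    qed
    ultimately show ?L by blast
  qed
  also have "\<dots> \<longleftrightarrow> \<not> (\<forall>X. X \<subseteq> U \<and> X \<noteq> {} \<and> R `` X \<inter> U \<subseteq> X \<longrightarrow> X = U)"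
    by (simp add: psubset_eq) metis
  finally have no_split: "\<not> ?L \<longleftrightarrow>
      (\<forall>X. X \<subseteq> U \<and> X \<noteq> {} \<and> R `` X \<inter> U \<subseteq> X \<longrightarrow> X = U)"
    by (simp only: not_not)
  show ?thesis
    unfolding irreducible_pattern_iff D_def[symmetric] m_def[symmetric] U_def[symmetric] no_split
    by (simp only: nonsing simp_thms)
qed

text \<open>By \<open>btf_columns\<close>, a row and its matched column have the same block index,
  so triangularity says that no edge of \<open>R\<close> lowers the index. Induction extends this to
  paths.\<close>

lemma btf_reach_index:
  assumes btf: "block_triangular_form n A \<rho> \<kappa> N" and reach: "(x, y) \<in> R\<^sup>*"
    and k: "k < length N" "x \<in> \<rho> ` block N k" and l: "l < length N" "y \<in> \<rho> ` block N l"
  shows "k \<le> l"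
  using reach l
proof (induction arbitrary: l rule: rtrancl_induct)
  case base
  have "inj \<rho>"
    using btf by (auto simp: block_triangular_form_def square_block_form_def permutes_inj)
  then have "block N k \<inter> block N l \<noteq> {}"
    using k(2) base(2) by (auto dest: injD)
  then show ?case using block_disjoint[of k l N] by auto
next
  case (step y z)
  have sq: "\<rho> permutes {1..n}" "\<kappa> permutes {1..n}" "sum_list N = n"
    using btf by (auto simp: block_triangular_form_def square_block_form_def)
  have yz: "y \<in> {1..n}" "z \<in> {1..n}" "(y, \<tau> z) \<in> A"
    using step(2) by (auto simp: row_digraph_def)
  then obtain i where i: "i \<in> {1..n}" "y = \<rho> i"
    using permutes_image[OF sq(1)] by blast
  then obtain m where m: "m < length N" "i \<in> block N m" using block_index sq(3) by metis
  have "\<tau> z \<in> \<kappa> ` block N l"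
    using btf_columns[OF btf step(4)] step(5) by blast
  then obtain j where j: "j \<in> block N l" "\<tau> z = \<kappa> j" by blast
  then have "j \<in> {1..n}" using block_subset[of N l] sq(3) by blast
  then have "(i, j) \<in> permuted_pattern n \<rho> \<kappa> A \<inter> (block N m \<times> block N l)"
    using yz i m j by (auto simp: permuted_pattern_def)
  then have "\<not> l < m"
    using btf m(1) step(4) by (auto simp: block_triangular_form_def)
  moreover have "k \<le> m" using step(3)[OF m(1)] i m(2) by blast
  ultimately show ?case by simp
qed

text \<open>The part of a block reachable from one of its rows is closed, hence the whole block, so
  the block is strongly connected. A row mutually reachable with it has the same block index by
  \<open>btf_reach_index\<close> in both directions.\<close>

lemma irreducible_BTF_block_eq:
  assumes irr: "irreducible_BTF n A \<rho> \<kappa> N" and l: "l < length N" and x: "x \<in> \<rho> ` block N l"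
  shows "strong_component n R x = \<rho> ` block N l"
proof -
  have btf: "block_triangular_form n A \<rho> \<kappa> N" and sq: "square_block_form n \<rho> \<kappa> N"
    using irr by (auto simp: irreducible_BTF_def block_triangular_form_def)
  have "irreducible_pattern (N ! l) (diagonal_subpattern n A \<rho> \<kappa> N l)"
    using irr l by (auto simp: irreducible_BTF_def)
  then have closed: "X = \<rho> ` block N l"
    if "X \<subseteq> \<rho> ` block N l" "X \<noteq> {}" "R `` X \<inter> \<rho> ` block N l \<subseteq> X" for X
    using diagonal_subpattern_irreducible_iff[OF sq l btf_columns[OF btf l]] that by blast
  have reach: "(u, v) \<in> R\<^sup>*" if "u \<in> \<rho> ` block N l" "v \<in> \<rho> ` block N l" for u v
  proof -
    have "{z \<in> \<rho> ` block N l. (u, z) \<in> R\<^sup>*} = \<rho> ` block N l"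
      by (rule closed) (use that in \<open>auto intro: rtrancl_into_rtrancl\<close>)
    then show ?thesis using that by blast
  qed
  have img: "\<rho> ` {1..n} = {1..n}" and n: "sum_list N = n"
    using sq permutes_image[of \<rho> "{1..n}"] by (simp_all add: square_block_form_def)
  have sub: "\<rho> ` block N l \<subseteq> {1..n}"
    using image_mono[OF block_subset[of N l], of \<rho>] img n by simp
  have "y \<in> \<rho> ` block N l" if y: "y \<in> {1..n}" "(x, y) \<in> R\<^sup>*" "(y, x) \<in> R\<^sup>*" for y
  proof -
    obtain i where i: "i \<in> {1..n}" "y = \<rho> i" using y(1) img by blast
    then obtain m where m: "m < length N" "i \<in> block N m" using block_index n by metis
    then have ym: "y \<in> \<rho> ` block N m" using i by blast
    have "m = l"
      using btf_reach_index[OF btf y(2) l x m(1) ym] btf_reach_index[OF btf y(3) m(1) ym l x] by simp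
    then show ?thesis using ym by simp
  qed
  then show ?thesis
    using reach sub x by (auto simp: strong_component_def)
qed

text \<open>This is the uniqueness half of the emblem: the right side does not mention the form.
  Blocks have positive size, so each one really contributes a component.\<close>

lemma irreducible_BTF_emblem:
  assumes irr: "irreducible_BTF n A \<rho> \<kappa> N"
  shows "emblem \<rho> \<kappa> N = matching_emblem n \<tau> A"
proof -
  have btf: "block_triangular_form n A \<rho> \<kappa> N" and sq: "square_block_form n \<rho> \<kappa> N"
    using irr by (auto simp: irreducible_BTF_def block_triangular_form_def)
  have img: "\<rho> ` {1..n} = {1..n}" and n: "sum_list N = n" and pos: "\<forall>m\<in>set N. m > 0"
    using sq permutes_image[of \<rho> "{1..n}"] by (simp_all add: square_block_form_def)
  have eq: "(strong_component n R x, \<tau> ` strong_component n R x) = (\<rho> ` block N l, \<kappa> ` block N l)"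
    if "l < length N" "x \<in> \<rho> ` block N l" for l x
    using irreducible_BTF_block_eq[OF irr that] btf_columns[OF btf that(1)] by simp
  show ?thesis
  proof (intro equalityI subsetI)
    fix p assume "p \<in> emblem \<rho> \<kappa> N"
    then obtain l where l: "l < length N" "p = (\<rho> ` block N l, \<kappa> ` block N l)"
      by (auto simp: emblem_def)
    have "block N l \<noteq> {}" using l(1) pos by (simp add: block_Suc)
    then obtain i where i: "i \<in> block N l" by blast
    then have "\<rho> i \<in> {1..n}" using block_subset[of N l] n img by blast
    then show "p \<in> matching_emblem n \<tau> A"
      using eq[OF l(1) imageI[OF i]] l(2) unfolding matching_emblem_def by (metis (no_types, lifting) imageI)
  next
    fix p assume "p \<in> matching_emblem n \<tau> A"
    then obtain x where x: "x \<in> {1..n}" "p = (strong_component n R x, \<tau> ` strong_component n R x)"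
      by (auto simp: matching_emblem_def)
    then obtain i where i: "i \<in> {1..n}" "x = \<rho> i" using img by blast
    then obtain l where "l < length N" "i \<in> block N l" using block_index n by metis
    then have "l < length N" "p = (\<rho> ` block N l, \<kappa> ` block N l)"
      using eq[of l x] x(2) i(2) by auto
    then show "p \<in> emblem \<rho> \<kappa> N" unfolding emblem_def by blast
  qed
qed

text \<open>The strong components, listed in topological order, serve as row blocks, each with its
  matched columns. The order gives triangularity and strong connectivity gives
  irreducibility.\<close>

lemma irreducible_BTF_exists: "\<exists>\<rho> \<kappa> N. irreducible_BTF n A \<rho> \<kappa> N"
proof -
  \<comment> \<open>A component further upstream reaches more rows; subtracting from
    \<open>n\<close> makes it come first under ascending sorting. Reachable sets of components lie
    in \<open>{1..n}\<close>, so the natural subtraction does not truncate.\<close>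
  define h where "h C = n - card (R\<^sup>* `` C)" for C :: "nat set"
  define F where "F = strong_component n R ` {1..n}"
  obtain Cs0 where Cs0: "set Cs0 = F" "distinct Cs0"
    using finite_distinct_list[of F] by (auto simp: F_def)
  define Cs where "Cs = sort_key h Cs0"
  have Cs: "set Cs = F" "distinct Cs" by (simp_all add: Cs_def Cs0)
  have mem: "x \<in> strong_component n R x" if "x \<in> {1..n}" for x
    using that by (simp add: strong_component_def)
  have comp: "strong_component n R x = C" if "C \<in> F" "x \<in> C" for x C
    using that by (auto simp: F_def strong_component_def intro: rtrancl_trans)
  have comp_nth: "\<exists>x\<in>{1..n}. Cs ! l = strong_component n R x" if "l < length Cs" for l
    using nth_mem[OF that] unfolding Cs(1) F_def by blast
  have un: "\<Union> (set Cs) = {1..n}"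
    unfolding Cs(1) F_def using mem by (auto simp: strong_component_def)
  have disj: "disjoint_family_on ((!) Cs) {..<length Cs}"
    unfolding disjoint_family_on_def
  proof (intro ballI impI equals0I)
    fix k l x assume kl: "k \<in> {..<length Cs}" "l \<in> {..<length Cs}" "k \<noteq> l" "x \<in> Cs ! k \<inter> Cs ! l"
    then have "Cs ! k = Cs ! l"
      using comp[of "Cs ! k" x] comp[of "Cs ! l" x] nth_mem[of k Cs] nth_mem[of l Cs] Cs(1) by auto
    then show False using kl Cs(2) by (auto simp: nth_eq_iff_index_eq)
  qed
  define N where "N = map card Cs"
  obtain \<rho> where \<rho>: "\<rho> permutes {1..n}" "sum_list N = n"
    "\<And>l. l < length Cs \<Longrightarrow> \<rho> ` block N l = Cs ! l"
    using permutation_of_partition[OF disj un] unfolding N_def by blast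
  define \<kappa> where "\<kappa> = \<tau> \<circ> \<rho>"
  have pos: "\<forall>m\<in>set N. m > 0"
    unfolding N_def using Cs(1) mem
    by (auto simp: F_def card_gt_0_iff strong_component_def)
  have sq: "square_block_form n \<rho> \<kappa> N"
    unfolding square_block_form_def \<kappa>_def using \<rho> pos permutes_compose[OF \<rho>(1) perm] by simp
  \<comment> \<open>sorting by \<open>h\<close> is topological: an edge between components strictly shrinks the reachable set\<close>
  have edge: "k \<le> l" if kl: "k < length Cs" "l < length Cs" "x \<in> Cs ! k" "y \<in> Cs ! l" "(x, y) \<in> R" for k l x y
  proof (rule ccontr)
    assume "\<not> k \<le> l"
    then have less: "l < k" by simp
    have CF: "Cs ! k \<in> F" "Cs ! l \<in> F" using kl(1,2) Cs(1) nth_mem by blast+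
    have xy: "x \<in> {1..n}" "y \<in> {1..n}" using kl(5) by (auto simp: row_digraph_def)
    \<comment> \<open>All rows of a component reach the same set, so \<open>h\<close> can be
      evaluated at a single row.\<close>
    have im: "R\<^sup>* `` C = R\<^sup>* `` {z}" if "C \<in> F" "z \<in> C" for C z
      using comp[OF that] that(2) by (auto simp: strong_component_def intro: rtrancl_trans)
    have "(y, x) \<notin> R\<^sup>*"
    proof
      assume "(y, x) \<in> R\<^sup>*"
      then have "y \<in> strong_component n R x"
        using kl(5) xy by (auto simp: strong_component_def)
      then have "y \<in> Cs ! k" using comp[OF CF(1) kl(3)] by simp
      moreover have "Cs ! k \<inter> Cs ! l = {}"
        using disjoint_family_onD[OF disj, of k l] kl(1,2) less by simp
      ultimately show False using kl(4) by blast
    qed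
    moreover have "(y, z) \<in> R\<^sup>* \<Longrightarrow> (x, z) \<in> R\<^sup>*" for z
      using kl(5) by (rule converse_rtrancl_into_rtrancl)
    ultimately have "R\<^sup>* `` {y} \<subset> R\<^sup>* `` {x}" by blast
    moreover have sub: "R\<^sup>* `` {x} \<subseteq> {1..n}"
      using row_digraph_rtrancl_range xy(1) by blast
    ultimately have "card (R\<^sup>* `` {y}) < card (R\<^sup>* `` {x})"
      by (meson finite_atLeastAtMost finite_subset psubset_card_mono)
    moreover have "card (R\<^sup>* `` {x}) \<le> n" using card_mono[OF _ sub] by simp
    moreover have "h (Cs ! k) = n - card (R\<^sup>* `` {x})" "h (Cs ! l) = n - card (R\<^sup>* `` {y})"
      using im[OF CF(1) kl(3)] im[OF CF(2) kl(4)] by (simp_all add: h_def)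
    moreover have "h (Cs ! l) \<le> h (Cs ! k)"
      using sorted_nth_mono[of "map h Cs" l k] less kl(1) by (simp add: Cs_def)
    ultimately show False by linarith
  qed
  have btf: "block_triangular_form n A \<rho> \<kappa> N"
    unfolding block_triangular_form_def
  proof (intro conjI sq allI impI equals0I)
    fix k l p assume kl: "k < length N" "l < length N" "l < k"
      and p: "p \<in> permuted_pattern n \<rho> \<kappa> A \<inter> (block N k \<times> block N l)"
    obtain i j where ij: "p = (i, j)" "i \<in> block N k" "j \<in> block N l" "i \<in> {1..n}" "j \<in> {1..n}"
      "(\<rho> i, \<tau> (\<rho> j)) \<in> A"
      using p by (auto simp: permuted_pattern_def \<kappa>_def)
    have len: "length N = length Cs" by (simp add: N_def)
    have "\<rho> i \<in> {1..n}" "\<rho> j \<in> {1..n}"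
      using ij permutes_in_image[OF \<rho>(1)] by blast+
    then have "(\<rho> i, \<rho> j) \<in> R" using ij by (simp add: row_digraph_def)
    moreover have "\<rho> i \<in> Cs ! k" "\<rho> j \<in> Cs ! l"
      using \<rho>(3) kl len ij by (metis imageI)+
    ultimately have "k \<le> l" using edge[of k l] kl len by simp
    then show False using kl(3) by simp
  qed
  have "irreducible_pattern (N ! l) (diagonal_subpattern n A \<rho> \<kappa> N l)" if l: "l < length N" for l
  proof -
    have U: "\<rho> ` block N l = Cs ! l" and CF: "Cs ! l \<in> F"
      using l \<rho>(3) Cs(1) by (auto simp: N_def)
    have "X = Cs ! l" if X: "X \<subseteq> Cs ! l" "X \<noteq> {}" "R `` X \<inter> Cs ! l \<subseteq> X" for X
    proof -
      obtain x where x: "x \<in> X" "x \<in> Cs ! l" using X by blast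
      have Cx: "Cs ! l = strong_component n R x" using comp[OF CF x(2)] by simp
      \<comment> \<open>Every row on a walk from \<open>x\<close> to a row that can return to
        \<open>x\<close> can itself return, so the walk stays in the component and, by closedness,
        in \<open>X\<close>.\<close>
      have "(z, x) \<in> R\<^sup>* \<longrightarrow> z \<in> X" if "(x, z) \<in> R\<^sup>*" for z
        using that
      proof (induction rule: rtrancl_induct)
        case (step y z)
        show ?case
        proof
          assume z: "(z, x) \<in> R\<^sup>*"
          then have "(y, x) \<in> R\<^sup>*" using step(2) by (rule converse_rtrancl_into_rtrancl[rotated])
          then have "y \<in> X" using step(3) by blast
          moreover have "z \<in> Cs ! l"
            using z step(1,2) unfolding Cx strong_component_def
            by (auto simp: row_digraph_def intro: rtrancl_into_rtrancl)
          ultimately show "z \<in> X" using step(2) X(3) by blast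
        qed
      qed (use x in simp)
      then show ?thesis using X(1) unfolding Cx strong_component_def by blast
    qed
    then show ?thesis
      unfolding diagonal_subpattern_irreducible_iff[OF sq l btf_columns[OF btf l]] U by blast
  qed
  then show ?thesis using btf unfolding irreducible_BTF_def by blast
qed

lemma is_irreducible_emblem_matching: "is_irreducible_emblem n A (matching_emblem n \<tau> A)"
  using irreducible_BTF_exists irreducible_BTF_emblem unfolding is_irreducible_emblem_def by blast

text \<open>An entry in an off-diagonal block would be an edge with a path back;
  \<open>btf_reach_index\<close> in both directions makes the two block indices equal.\<close>

lemma block_diagonal_if_symmetric_reach:
  assumes irr: "irreducible_BTF n A \<rho> \<kappa> N" and sym: "\<And>x y. (x, y) \<in> R \<Longrightarrow> (y, x) \<in> R\<^sup>*"
  shows "block_diagonal_form n A \<rho> \<kappa> N"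
proof -
  have btf: "block_triangular_form n A \<rho> \<kappa> N" and sq: "square_block_form n \<rho> \<kappa> N"
    using irr by (auto simp: irreducible_BTF_def block_triangular_form_def)
  show ?thesis
    unfolding block_diagonal_form_def
  proof (intro conjI sq allI impI equals0I)
    fix k l p assume kl: "k < length N" "l < length N" "k \<noteq> l"
      and p: "p \<in> permuted_pattern n \<rho> \<kappa> A \<inter> (block N k \<times> block N l)"
    obtain i j where ij: "p = (i, j)" "i \<in> block N k" "j \<in> block N l" "i \<in> {1..n}" "(\<rho> i, \<kappa> j) \<in> A"
      using p by (auto simp: permuted_pattern_def)
    have "\<kappa> j \<in> \<tau> ` \<rho> ` block N l" using btf_columns[OF btf kl(2)] ij(3) by blast
    then obtain y where y: "y \<in> \<rho> ` block N l" "\<kappa> j = \<tau> y" by blast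
    have img: "\<rho> ` {1..n} = {1..n}" and n: "sum_list N = n"
      using sq permutes_image[of \<rho> "{1..n}"] by (simp_all add: square_block_form_def)
    have "y \<in> {1..n}" "\<rho> i \<in> {1..n}"
      using y(1) ij(4) img n block_subset[of N l] by blast+
    then have e: "(\<rho> i, y) \<in> R" using ij(5) y(2) by (simp add: row_digraph_def)
    have i: "\<rho> i \<in> \<rho> ` block N k" using ij by blast
    have "k = l"
      using btf_reach_index[OF btf r_into_rtrancl[OF e] kl(1) i kl(2) y(1)]
        btf_reach_index[OF btf sym[OF e] kl(2) y(1) kl(1) i] by simp
    then show False using kl(3) by simp
  qed
qed

end

section \<open>Transversals, permutations and cycles of the digraph\<close>

section \<open>Transversals as permutations\<close>

lemma transversal_graph:
  assumes "\<sigma> permutes {1..n}"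
  shows "transversal n ((\<lambda>i. (i, \<sigma> i)) ` {1..n})"
  unfolding transversal_def
proof (intro conjI ballI)
  show "(\<lambda>i. (i, \<sigma> i)) ` {1..n} \<subseteq> {1..n} \<times> {1..n}"
    using permutes_in_image[OF assms] by blast
next
  fix i assume "i \<in> {1..n}"
  then show "\<exists>!j. (i, j) \<in> (\<lambda>i. (i, \<sigma> i)) ` {1..n}" by (intro ex1I[of _ "\<sigma> i"]) blast+
next
  fix j assume "j \<in> {1..n}"
  then obtain i where i: "i \<in> {1..n}" "j = \<sigma> i" using permutes_image[OF assms] by blast
  show "\<exists>!i. (i, j) \<in> (\<lambda>i. (i, \<sigma> i)) ` {1..n}"
    by (rule ex1I[of _ i]) (use i in \<open>auto simp: inj_eq[OF permutes_inj[OF assms]]\<close>)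
qed

lemma transversal_imp_graph:
  assumes "transversal n T"
  obtains \<sigma> where "\<sigma> permutes {1..n}" "T = (\<lambda>i. (i, \<sigma> i)) ` {1..n}"
proof -
  have sub: "T \<subseteq> {1..n} \<times> {1..n}" and row: "\<And>i. i \<in> {1..n} \<Longrightarrow> \<exists>!j. (i, j) \<in> T"
    and col: "\<And>j. j \<in> {1..n} \<Longrightarrow> \<exists>!i. (i, j) \<in> T"
    using assms by (auto simp: transversal_def)
  define \<sigma> where "\<sigma> i = (if i \<in> {1..n} then THE j. (i, j) \<in> T else i)" for i
  have in_T: "(i, \<sigma> i) \<in> T" if "i \<in> {1..n}" for i
    using theI'[OF row[OF that]] that by (simp add: \<sigma>_def)
  have T: "T = (\<lambda>i. (i, \<sigma> i)) ` {1..n}"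
  proof (intro equalityI subsetI)
    fix p assume "p \<in> T"
    moreover obtain i j where ij: "p = (i, j)" by fastforce
    ultimately have "i \<in> {1..n}" using sub by blast
    then have "j = \<sigma> i" using row in_T \<open>p \<in> T\<close> ij by blast
    then show "p \<in> (\<lambda>i. (i, \<sigma> i)) ` {1..n}" using ij \<open>i \<in> {1..n}\<close> by blast
  qed (use in_T in blast)
  have "inj_on \<sigma> {1..n}"
  proof (rule inj_onI)
    fix i k assume ik: "i \<in> {1..n}" "k \<in> {1..n}" "\<sigma> i = \<sigma> k"
    then have "(i, \<sigma> i) \<in> T" "(k, \<sigma> i) \<in> T" using in_T[of i] in_T[of k] by auto
    moreover have "\<sigma> i \<in> {1..n}" using \<open>(i, \<sigma> i) \<in> T\<close> sub by blast
    ultimately show "i = k" using col by blast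
  qed
  moreover have "\<sigma> ` {1..n} \<subseteq> {1..n}" using in_T sub by blast
  ultimately have "bij_betw \<sigma> {1..n} {1..n}"
    by (simp add: bij_betw_def endo_inj_surj)
  then have "\<sigma> permutes {1..n}"
    by (rule bij_imp_permutes) (auto simp: \<sigma>_def)
  then show ?thesis using T that by blast
qed

lemma transversal_value_graph:
  "transversal_value \<Sigma> ((\<lambda>i. (i, \<sigma> i)) ` {1..n}) = (\<Sum>i\<in>{1..n}. \<Sigma> i (\<sigma> i))"
  unfolding transversal_value_def by (subst sum.reindex) (auto simp: inj_on_def)

text \<open>Rotating the matched rows along a simple cycle through the edge gives the transversal.\<close>

lemma (in matched_pattern) edge_on_cycle_in_transversal:
  assumes e: "(x, y) \<in> R" and return: "(y, x) \<in> R\<^sup>*"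
  obtains T where "transversal n T" "T \<subseteq> A" "(x, \<tau> y) \<in> T"
proof -
  have "(\<lambda>u v. (u, v) \<in> R)\<^sup>*\<^sup>* y x" using return by (simp add: rtranclp_rtrancl_eq)
  then obtain xs0 where "rtrancl_path (\<lambda>u v. (u, v) \<in> R) y xs0 x"
    unfolding rtranclp_eq_rtrancl_path by blast
  then obtain xs where path: "rtrancl_path (\<lambda>u v. (u, v) \<in> R) y xs x" and dist: "distinct (y # xs)"
    using rtrancl_path_distinct by metis
  define cs where "cs = y # xs"
  \<comment> \<open>\<open>cs\<close> is a simple path from \<open>y\<close> to \<open>x\<close>.
    Its cycle sends each row to its successor and \<open>x\<close> back to \<open>y\<close> along
    the given edge.\<close>
  define \<pi> where "\<pi> = cycle_of_list cs"
  have "last cs = x"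
    using rtrancl_path_last[OF path] path by (cases xs) (auto simp: cs_def elim: rtrancl_path.cases)
  then have last: "cs ! length xs = x"
    using last_conv_nth[of cs] by (simp add: cs_def split: if_splits)
  have "map \<pi> cs = rotate1 cs"
    using cyclic_rotation[of cs 1] dist by (simp add: \<pi>_def cs_def del: cycle_of_list.simps)
  then have rot: "\<pi> (cs ! i) = (xs @ [y]) ! i" if "i < length cs" for i
    using that by (metis cs_def nth_map rotate1.simps(2))
  have len: "length cs = Suc (length xs)" by (simp add: cs_def)
  have step: "(cs ! i, \<pi> (cs ! i)) \<in> R" if i: "i < length cs" for i
  proof (cases "i < length xs")
    case True
    then show ?thesis
      using rtrancl_path_nth[OF path True] rot[OF i] by (simp add: cs_def nth_append)
  next
    case False
    then have "i = length xs" using i len by simp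
    then have "cs ! i = x" using last by simp
    then show ?thesis using rot[OF i] e \<open>i = length xs\<close> by simp
  qed
  have \<pi>x: "\<pi> x = y"
    using rot[of "length xs"] last len by simp
  have edge: "(z, \<pi> z) \<in> R" if "z \<in> {1..n}" for z
  proof (cases "z \<in> set cs")
    case True
    then show ?thesis using step by (metis in_set_conv_nth)
  next
    case False
    \<comment> \<open>Off the cycle the matching is kept, and the edge is the loop at
      \<open>z\<close>.\<close>
    then have "\<pi> z = z" by (simp add: \<pi>_def id_outside_supp)
    then show ?thesis using that matched by (simp add: row_digraph_def)
  qed
  have "set cs \<subseteq> {1..n}"
    using step by (force simp: in_set_conv_nth row_digraph_def)
  then have "\<pi> permutes {1..n}"
    unfolding \<pi>_def using cycle_permutes by (rule permutes_subset[rotated])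
  then have "\<tau> \<circ> \<pi> permutes {1..n}" using perm by (rule permutes_compose)
  then have "transversal n ((\<lambda>z. (z, (\<tau> \<circ> \<pi>) z)) ` {1..n})" by (rule transversal_graph)
  moreover have "(\<lambda>z. (z, (\<tau> \<circ> \<pi>) z)) ` {1..n} \<subseteq> A"
    using edge by (auto simp: row_digraph_def)
  moreover have "(x, \<tau> y) \<in> (\<lambda>z. (z, (\<tau> \<circ> \<pi>) z)) ` {1..n}"
    using e \<pi>x by (auto simp: row_digraph_def image_iff)
  ultimately show ?thesis by (rule that)
qed

text \<open>A second transversal differs from the matching by a permutation of the rows, whose cycles are
  directed cycles of the digraph.\<close>

lemma (in matched_pattern) edge_in_transversal_on_cycle:
  assumes T: "transversal n T" "T \<subseteq> A" and xy: "(x, \<tau> y) \<in> T" "x \<in> {1..n}"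
  shows "(y, x) \<in> R\<^sup>*"
proof -
  obtain \<sigma> where \<sigma>: "\<sigma> permutes {1..n}" "T = (\<lambda>i. (i, \<sigma> i)) ` {1..n}"
    using transversal_imp_graph[OF T(1)] by blast
  define \<pi> where "\<pi> = inv \<tau> \<circ> \<sigma>"
  have \<pi>: "\<pi> permutes {1..n}"
    unfolding \<pi>_def by (intro permutes_compose \<sigma> permutes_inv perm)
  have \<tau>\<pi>: "\<tau> (\<pi> z) = \<sigma> z" for z
    using permutes_inverses(1)[OF perm] by (simp add: \<pi>_def)
  have edge: "(z, \<pi> z) \<in> R" if "z \<in> {1..n}" for z
    using that T(2) \<sigma>(2) permutes_in_image[OF \<pi>, of z] by (auto simp: row_digraph_def \<tau>\<pi>)
  have "\<tau> (\<pi> x) = \<tau> y" using xy \<sigma>(2) by (auto simp: \<tau>\<pi>)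
  then have \<pi>x: "\<pi> x = y" using permutes_inj[OF perm] by (simp add: inj_eq)
  have iter: "(y, (\<pi> ^^ k) y) \<in> R\<^sup>* \<and> (\<pi> ^^ k) y \<in> {1..n}" for k
  proof (induction k)
    case 0
    show ?case using \<pi>x xy(2) permutes_in_image[OF \<pi>, of x] by simp
  next
    case (Suc k)
    then show ?case
      using edge[of "(\<pi> ^^ k) y"] permutes_in_image[OF \<pi>, of "(\<pi> ^^ k) y"]
      by (auto intro: rtrancl_into_rtrancl)
  qed
  have "permutation \<pi>" using \<pi> by (auto simp: permutation_permutes)
  \<comment> \<open>As \<open>\<pi>\<close> has finite order and \<open>\<pi> x = y\<close>,
    iterating it \<open>m - 1\<close> more times from \<open>y\<close> returns to
    \<open>x\<close>.\<close>
  then obtain m where m: "\<pi> ^^ m = id" "m > 0" by (rule permutation_is_nilpotent)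
  have "(\<pi> ^^ (m - 1)) y = (\<pi> ^^ m) x"
    using \<pi>x m(2) by (cases m) (simp_all add: funpow_swap1)
  then show ?thesis using iter[of "m - 1"] m(1) by simp
qed

section \<open>Offsets as dual bounds on transversal values\<close>

section \<open>Highest-value transversals\<close>

lemma HVT_exists: "\<exists>T. HVT n \<Sigma> T"
proof -
  define V where "V = transversal_value \<Sigma> ` {T. transversal n T}"
  have "{T. transversal n T} \<subseteq> Pow ({1..n} \<times> {1..n})" by (auto simp: transversal_def)
  then have fin: "finite V"
    unfolding V_def by (intro finite_imageI) (auto intro: finite_subset)
  moreover have "V \<noteq> {}"
    using transversal_graph[OF permutes_id, of n] by (auto simp: V_def)
  ultimately have "Max V \<in> V" by (rule Max_in)
  then obtain T where T: "transversal n T" "Max V = transversal_value \<Sigma> T"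
    by (auto simp: V_def)
  have "transversal_value \<Sigma> T' \<le> transversal_value \<Sigma> T" if "transversal n T'" for T'
    unfolding T(2)[symmetric] by (rule Max_ge[OF fin]) (use that in \<open>auto simp: V_def\<close>)
  then show ?thesis using T by (auto simp: HVT_def)
qed

text \<open>Each column is used exactly once, so the total is the same for every
  \<open>\<sigma>\<close>. It is the dual objective of the assignment problem.\<close>

lemma offset_sum:
  fixes c d :: "nat \<Rightarrow> int"
  assumes "\<sigma> permutes {1..n}"
  shows "(\<Sum>i\<in>{1..n}. ereal (real_of_int (d (\<sigma> i) - c i)))
    = ereal (real_of_int (sum d {1..n} - sum c {1..n}))"
proof -
  have "(\<Sum>i\<in>{1..n}. d (\<sigma> i)) = sum d {1..n}"
    by (rule sum.permute[OF assms, of d, unfolded comp_def, symmetric])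
  then have "(\<Sum>i\<in>{1..n}. d (\<sigma> i) - c i) = sum d {1..n} - sum c {1..n}"
    by (simp only: sum_subtractf)
  then show ?thesis by (simp only: sum_ereal flip: of_int_sum)
qed

text \<open>Validity makes the offsets tight on one highest-value transversal, and all of these
  share one value.\<close>

lemma HVT_value_offset:
  assumes off: "valid_offset n \<Sigma> c d" and T: "HVT n \<Sigma> T"
  shows "transversal_value \<Sigma> T = ereal (real_of_int (sum d {1..n} - sum c {1..n}))"
proof -
  obtain T0 where T0: "HVT n \<Sigma> T0"
    and eq: "\<forall>(i, j)\<in>T0. ereal (real_of_int (d j - c i)) = \<Sigma> i j"
    using off by (auto simp: valid_offset_def)
  obtain \<sigma> where \<sigma>: "\<sigma> permutes {1..n}" "T0 = (\<lambda>i. (i, \<sigma> i)) ` {1..n}"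
    using T0 transversal_imp_graph unfolding HVT_def by blast
  have "transversal_value \<Sigma> T0 = (\<Sum>i\<in>{1..n}. ereal (real_of_int (d (\<sigma> i) - c i)))"
    unfolding \<sigma>(2) transversal_value_graph by (rule sum.cong) (use eq \<sigma>(2) in auto)
  moreover have "transversal_value \<Sigma> T = transversal_value \<Sigma> T0"
    using T T0 by (auto simp: HVT_def intro: antisym)
  ultimately show ?thesis using offset_sum[OF \<sigma>(1)] by simp
qed

text \<open>Complementary slackness: the entries of \<open>T\<close> are bounded by offset
  differences whose total is the maximal value, so this value is attained exactly when every bound
  is tight.\<close>

lemma HVT_iff_subset_S_0:
  assumes off: "valid_offset n \<Sigma> c d" and T: "transversal n T"
  shows "HVT n \<Sigma> T \<longleftrightarrow> T \<subseteq> S_0 n \<Sigma> c d"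
proof -
  obtain \<sigma> where \<sigma>: "\<sigma> permutes {1..n}" "T = (\<lambda>i. (i, \<sigma> i)) ` {1..n}"
    using transversal_imp_graph[OF T] by blast
  define e where "e i = real_of_int (d (\<sigma> i) - c i)" for i
  define v where "v = ereal (real_of_int (sum d {1..n} - sum c {1..n}))"
  have v: "(\<Sum>i\<in>{1..n}. ereal (e i)) = v"
    unfolding e_def v_def by (rule offset_sum[OF \<sigma>(1)])
  have in_S_0: "T \<subseteq> S_0 n \<Sigma> c d \<longleftrightarrow> (\<forall>i\<in>{1..n}. ereal (e i) = \<Sigma> i (\<sigma> i))"
    unfolding \<sigma>(2) S_0_def e_def image_subset_iff using permutes_in_image[OF \<sigma>(1)] by blast
  have le: "\<Sigma> i (\<sigma> i) \<le> ereal (e i)" if "i \<in> {1..n}" for i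
    using off that permutes_in_image[OF \<sigma>(1), of i] unfolding valid_offset_def e_def by blast
  show ?thesis
  proof
    assume "T \<subseteq> S_0 n \<Sigma> c d"
    then have "(\<Sum>i\<in>{1..n}. \<Sigma> i (\<sigma> i)) = (\<Sum>i\<in>{1..n}. ereal (e i))"
      unfolding in_S_0 by (intro sum.cong) simp_all
    then have "transversal_value \<Sigma> T = v"
      unfolding \<sigma>(2) transversal_value_graph v .
    moreover obtain T0 where "HVT n \<Sigma> T0" using off by (auto simp: valid_offset_def)
    ultimately show "HVT n \<Sigma> T"
      using HVT_value_offset[OF off \<open>HVT n \<Sigma> T0\<close>] T by (auto simp: HVT_def v_def)
  next
    assume hvt: "HVT n \<Sigma> T"
    have val: "(\<Sum>i\<in>{1..n}. \<Sigma> i (\<sigma> i)) = v"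
      using HVT_value_offset[OF off hvt] unfolding \<sigma>(2) transversal_value_graph v_def .
    have "ereal (e i) = \<Sigma> i (\<sigma> i)" if i: "i \<in> {1..n}" for i
    proof (rule ccontr)
      assume "ereal (e i) \<noteq> \<Sigma> i (\<sigma> i)"
      then have less: "\<Sigma> i (\<sigma> i) < ereal (e i)" using le[OF i] by simp
      \<comment> \<open>The remaining bounds sum to a real number, so adding \<open>r\<close>
        preserves strict inequality, even if the slack entry is minus infinity.\<close>
      define r where "r = (\<Sum>k\<in>{1..n} - {i}. e k)"
      have "v = \<Sigma> i (\<sigma> i) + (\<Sum>k\<in>{1..n} - {i}. \<Sigma> k (\<sigma> k))"
        unfolding val[symmetric] using i by (intro sum.remove) auto
      also have "\<dots> \<le> \<Sigma> i (\<sigma> i) + (\<Sum>k\<in>{1..n} - {i}. ereal (e k))"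
        by (intro add_left_mono sum_mono le) auto
      also have "\<dots> = \<Sigma> i (\<sigma> i) + ereal r" by (simp add: r_def)
      also have "\<dots> < ereal (e i) + ereal r"
        using less by (cases "\<Sigma> i (\<sigma> i)") auto
      also have "\<dots> = v"
        unfolding v[symmetric] r_def using i sum.remove[of "{1..n}" i "\<lambda>k. ereal (e k)"] by simp
      finally show False by simp
    qed
    then show "T \<subseteq> S_0 n \<Sigma> c d" unfolding in_S_0 by blast
  qed
qed

section \<open>Comparison of the essential pattern with the Jacobian patterns\<close>

lemma S_ess_subset_S_0:
  assumes "valid_offset n \<Sigma> c d"
  shows "S_ess n \<Sigma> \<subseteq> S_0 n \<Sigma> c d"
proof
  fix p assume "p \<in> S_ess n \<Sigma>"
  then obtain T where T: "HVT n \<Sigma> T" "p \<in> T" by (auto simp: S_ess_def)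
  then have "transversal n T" by (simp add: HVT_def)
  then show "p \<in> S_0 n \<Sigma> c d" using HVT_iff_subset_S_0[OF assms] T by blast
qed

text \<open>The larger pattern may add edges, but one with a return path lies on a transversal
  inside \<open>S_0 n \<Sigma> c d\<close>, which has highest value, so the edge is already in the
  essential pattern. Mutual reachability is therefore the same in both digraphs.\<close>

lemma matching_emblem_S_0:
  assumes off: "valid_offset n \<Sigma> c d" and \<tau>: "\<tau> permutes {1..n}"
    and hvt: "HVT n \<Sigma> ((\<lambda>i. (i, \<tau> i)) ` {1..n})"
  shows "matched_pattern n \<tau> (S_0 n \<Sigma> c d)"
    and "matching_emblem n \<tau> (S_0 n \<Sigma> c d) = matching_emblem n \<tau> (S_ess n \<Sigma>)"
proof -
  let ?E = "row_digraph n \<tau> (S_ess n \<Sigma>)" and ?J = "row_digraph n \<tau> (S_0 n \<Sigma> c d)"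
  show mp: "matched_pattern n \<tau> (S_0 n \<Sigma> c d)"
    using \<tau> hvt HVT_iff_subset_S_0[OF off transversal_graph[OF \<tau>]]
    by unfold_locales (simp, blast)
  then interpret J: matched_pattern n \<tau> "S_0 n \<Sigma> c d" .
  have "?E \<subseteq> ?J" using S_ess_subset_S_0[OF off] by (auto simp: row_digraph_def)
  then have mono: "?E\<^sup>* \<subseteq> ?J\<^sup>*" by (rule rtrancl_mono)
  have edge: "(x, y) \<in> ?E" if xy: "(x, y) \<in> ?J" "(y, x) \<in> ?J\<^sup>*" for x y
  proof -
    obtain T where T: "transversal n T" "T \<subseteq> S_0 n \<Sigma> c d" "(x, \<tau> y) \<in> T"
      using J.edge_on_cycle_in_transversal[OF xy] by blast
    then have "(x, \<tau> y) \<in> S_ess n \<Sigma>"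
      using HVT_iff_subset_S_0[OF off T(1)] by (auto simp: S_ess_def)
    then show ?thesis using xy(1) by (simp add: row_digraph_def)
  qed
  \<comment> \<open>The condition that the end of the walk can return to its start passes to
    prefixes and gives each edge a return path, so the whole walk lies in \<open>?E\<close>.\<close>
  have "(y, x) \<in> ?J\<^sup>* \<longrightarrow> (x, y) \<in> ?E\<^sup>*" if "(x, y) \<in> ?J\<^sup>*" for x y
    using that
  proof (induction rule: rtrancl_induct)
    case (step z y)
    show ?case
    proof
      assume yx: "(y, x) \<in> ?J\<^sup>*"
      then have "(y, z) \<in> ?J\<^sup>*" using step(1) by (rule rtrancl_trans)
      then have "(z, y) \<in> ?E" using edge step(2) by blast
      moreover have "(z, x) \<in> ?J\<^sup>*" using step(2) yx by (rule converse_rtrancl_into_rtrancl)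
      ultimately show "(x, y) \<in> ?E\<^sup>*" using step(3) by (blast intro: rtrancl_into_rtrancl)
    qed
  qed simp
  then have "strong_component n ?J x = strong_component n ?E x" for x
    using mono unfolding strong_component_def by blast
  then show "matching_emblem n \<tau> (S_0 n \<Sigma> c d) = matching_emblem n \<tau> (S_ess n \<Sigma>)"
    by (simp add: matching_emblem_def)
qed

theorem corollary4p6:
  fixes n :: nat and \<Sigma> :: "nat \<Rightarrow> nat \<Rightarrow> ereal"
  assumes "signature_matrix n \<Sigma>"
    and "structurally_well_posed n \<Sigma>"
  shows "(\<forall>\<rho> \<kappa> N. irreducible_BTF n (S_ess n \<Sigma>) \<rho> \<kappa> N \<longrightarrow>
             block_diagonal_form n (S_ess n \<Sigma>) \<rho> \<kappa> N) \<and>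
         (\<exists>E. is_irreducible_emblem n (S_ess n \<Sigma>) E \<and>
             (\<forall>c d. valid_offset n \<Sigma> c d \<longrightarrow> is_irreducible_emblem n (S_0 n \<Sigma> c d) E))"
proof -
  obtain T where T: "HVT n \<Sigma> T" using HVT_exists by blast
  \<comment> \<open>One highest-value transversal serves as the matching for all patterns at once,
    so their emblems rest on the same identification of columns with rows.\<close>
  obtain \<tau> where \<tau>: "\<tau> permutes {1..n}" "T = (\<lambda>i. (i, \<tau> i)) ` {1..n}"
    using T transversal_imp_graph unfolding HVT_def by blast
  have hvt: "HVT n \<Sigma> ((\<lambda>i. (i, \<tau> i)) ` {1..n})" using T \<tau>(2) by simp
  interpret E: matched_pattern n \<tau> "S_ess n \<Sigma>"
    using \<tau>(1) hvt by unfold_locales (auto simp: S_ess_def)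
  \<comment> \<open>An entry of the essential pattern comes with a transversal inside that pattern,
    which closes its edge to a cycle.\<close>
  have "(y, x) \<in> E.R\<^sup>*" if xy: "(x, y) \<in> E.R" for x y
  proof -
    have "(x, \<tau> y) \<in> S_ess n \<Sigma>" "x \<in> {1..n}" using xy by (auto simp: row_digraph_def)
    then obtain T' where "HVT n \<Sigma> T'" "(x, \<tau> y) \<in> T'" by (auto simp: S_ess_def)
    then show ?thesis
      using \<open>x \<in> {1..n}\<close>
      by (intro E.edge_in_transversal_on_cycle[of T']) (auto simp: HVT_def S_ess_def)
  qed
  then have "block_diagonal_form n (S_ess n \<Sigma>) \<rho> \<kappa> N"
    if "irreducible_BTF n (S_ess n \<Sigma>) \<rho> \<kappa> N" for \<rho> \<kappa> N
    using E.block_diagonal_if_symmetric_reach[OF that] by blast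
  moreover have "is_irreducible_emblem n (S_0 n \<Sigma> c d) (matching_emblem n \<tau> (S_ess n \<Sigma>))"
    if "valid_offset n \<Sigma> c d" for c d
    using matched_pattern.is_irreducible_emblem_matching[OF matching_emblem_S_0(1)[OF that \<tau>(1) hvt]]
    unfolding matching_emblem_S_0(2)[OF that \<tau>(1) hvt] .
  ultimately show ?thesis using E.is_irreducible_emblem_matching by blast
qed

end
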